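(* Let $g,q,b\in\mathbb{R}$, $\alpha>0$, let $u_\alpha$ be the solution of $(S_\alpha)$, and for $h=x_0/n$ ($n\ge1$ an integer) let $\widetilde u^h_\alpha$ be the modified piecewise linear discrete approximation. Then $$\|u_\alpha-\widetilde u^h_\alpha\|_H\le D_2h^2,\qquad\left\|\frac{\partial u_\alpha}{\partial x}-\frac{\partial\widetilde u^h_\alpha}{\partial x}\right\|_H\le\widetilde D_2h,$$ where $D_2=\sqrt{\tfrac{x_0y_0}{120}}\,|g|$ and $\widetilde D_2=\sqrt{\tfrac{x_0y_0}{12}}\,|g|$.
   Context: Fix $x_0,y_0>0$, $\Omega=(0,x_0)\times(0,y_0)$, $\Gamma_1=\{0\}\times(0,y_0]$, $\Gamma_2=\{x_0\}\times(0,y_0]$, $\Gamma_3=[0,x_0]\times\{0,y_0\}$, $H=L^2(\Omega)$ with its standard norm. For constants $g,q,b\in\mathbb{R}$ and $\alpha>0$, system $(S_\alpha)$ is $-\Delta u=g$ in $\Omega$, $-\partial u/\partial n=\alpha(u-b)$ on $\Gamma_1$, $-\partial u/\partial n=q$ on $\Gamma_2$, $-\partial u/\partial n=0$ on $\Gamma_3$; its solution is $u_\alpha(x,y)=-\tfrac12gx^2+(gx_0-q)x+\tfrac1\alpha(gx_0-q)+b$. For an integer $n\ge1$ put $h=x_0/n$, $x_i=(i-1)h$, $i=1,\dots,n+1$. The modified discrete system is: $-(1+\alpha h)\widetilde u^h_{\alpha,1}+\widetilde u^h_{\alpha,2}=-\alpha hb-\tfrac{gh^2}2$; $\widetilde u^h_{\alpha,i+1}-2\widetilde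 u^h_{\alpha,i}+\widetilde u^h_{\alpha,i-1}=-gh^2$ for $i=2,\dots,n$; $-\widetilde u^h_{\alpha,n}+\widetilde u^h_{\alpha,n+1}=-qh+\tfrac{gh^2}2$ (the first and last equations come from combining the interior equations with the three-point approximations $\tfrac{-3\widetilde u^h_{\alpha,1}+4\widetilde u^h_{\alpha,2}-\widetilde u^h_{\alpha,3}}{2h}=\alpha(\widetilde u^h_{\alpha,1}-b)$ and $3\widetilde u^h_{\alpha,n+1}-4\widetilde u^h_{\alpha,n}+\widetilde u^h_{\alpha,n-1}=-2qh$). Its solution is $\widetilde u^h_{\alpha,i}=b+\tfrac1\alpha(gx_0-q)+(i-1)h(gx_0-q)-\tfrac g2((i-1)h)^2$. The function $\widetilde u^h_\alpha$ is the piecewise linear interpolant: $\widetilde u^h_\alpha(x,y)=\left(gx_0-q-gh\left(i-\tfrac12\right)\right)x+b+\tfrac1\alpha(gx_0-q)+\tfrac{gh^2}2(i-1)i$ for $x\in[x_i,x_{i+1}]$, $y\in[0,y_0]$, $i=1,\dots,n$; its $x$-derivative is piecewise constant, defined a.e. *)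

theory Defs
  imports "HOL-Analysis.Analysis"
begin

definition Omega :: "real \<Rightarrow> real \<Rightarrow> (real \<times> real) set" where
  "Omega x0 y0 = {0<..<x0} \<times> {0<..<y0}"

definition Gamma1 :: "real \<Rightarrow> (real \<times> real) set" where
  "Gamma1 y0 = {0} \<times> {0<..y0}"

definition Gamma2 :: "real \<Rightarrow> real \<Rightarrow> (real \<times> real) set" where
  "Gamma2 x0 y0 = {x0} \<times> {0<..y0}"

text \<open>
  Where a partial derivative does not exist, \<open>deriv\<close> returns an unspecified real. For a piecewise
  linear function of \<open>x\<close> this concerns only the finitely many vertical lines through the nodes,
  a null set.
\<close>

definition partial_x :: "(real \<times> real \<Rightarrow> real) \<Rightarrow> real \<times> real \<Rightarrow> real" where
  "partial_x u = (\<lambda>(x, y). deriv (\<lambda>s. u (s, y)) x)"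

definition partial_y :: "(real \<times> real \<Rightarrow> real) \<Rightarrow> real \<times> real \<Rightarrow> real" where
  "partial_y u = (\<lambda>(x, y). deriv (\<lambda>t. u (x, t)) y)"

definition twice_partially_differentiable_at ::
    "(real \<times> real \<Rightarrow> real) \<Rightarrow> real \<times> real \<Rightarrow> bool" where
  "twice_partially_differentiable_at u = (\<lambda>(x, y).
     (\<lambda>s. u (s, y)) differentiable at x \<and> (\<lambda>s. partial_x u (s, y)) differentiable at x \<and>
     (\<lambda>t. u (x, t)) differentiable at y \<and> (\<lambda>t. partial_y u (x, t)) differentiable at y)"

definition laplacian :: "(real \<times> real \<Rightarrow> real) \<Rightarrow> real \<times> real \<Rightarrow> real" where
  "laplacian u p = partial_x (partial_x u) p + partial_y (partial_y u) p"

text \<open>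
  The normal derivative at a boundary point \<open>p\<close> with outward unit normal \<open>\<nu>\<close> is one-sided:
  for \<open>t < 0\<close> near \<open>0\<close> the point \<open>p + t \<nu>\<close> lies in the closed rectangle, so values of \<open>u\<close>
  outside it play no role.
\<close>

definition has_normal_derivative ::
    "(real \<times> real \<Rightarrow> real) \<Rightarrow> real \<times> real \<Rightarrow> real \<times> real \<Rightarrow> real \<Rightarrow> bool" where
  "has_normal_derivative u \<nu> p d \<longleftrightarrow>
     ((\<lambda>t. u (p + t *\<^sub>R \<nu>)) has_real_derivative d) (at_left 0)"

text \<open>
  Classical solutions of the mixed problem, with the equations read pointwise. Regularity is the
  minimum needed to state them (continuity up to the boundary, second pure partial derivatives
  inside, one-sided normal derivatives on the boundary); it is implied by the usual requirement
  of being \<open>C\<^sup>2\<close> inside and \<open>C\<^sup>1\<close> up to the boundary. The third boundary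
  part \<open>[0, x0] \<times> {0, y0}\<close> consists of two sides with opposite normals. It contains all
  corners, and the corners at height \<open>y0\<close> also belong to a vertical side; there the
  condition of each part uses the normal of the side to which that part belongs.
\<close>

definition solves_S ::
    "real \<Rightarrow> real \<Rightarrow> real \<Rightarrow> real \<Rightarrow> real \<Rightarrow> real \<Rightarrow> (real \<times> real \<Rightarrow> real) \<Rightarrow> bool" where
  "solves_S x0 y0 g q b \<alpha> u \<longleftrightarrow>
     continuous_on (closure (Omega x0 y0)) u \<and>
     (\<forall>p\<in>Omega x0 y0. twice_partially_differentiable_at u p \<and> - laplacian u p = g) \<and>
     (\<forall>p\<in>Gamma1 y0. \<exists>d. has_normal_derivative u (-1, 0) p d \<and> - d = \<alpha> * (u p - b)) \<and>
     (\<forall>p\<in>Gamma2 x0 y0. \<exists>d. has_normal_derivative u (1, 0) p d \<and> - d = q) \<and>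
     (\<forall>p\<in>{0..x0} \<times> {0}. \<exists>d. has_normal_derivative u (0, -1) p d \<and> - d = 0) \<and>
     (\<forall>p\<in>{0..x0} \<times> {y0}. \<exists>d. has_normal_derivative u (0, 1) p d \<and> - d = 0)"

definition node :: "real \<Rightarrow> nat \<Rightarrow> real" where
  "node h i = (real i - 1) * h"

text \<open>Only the entries \<open>U 1, \<dots>, U (n + 1)\<close> of the nodal vector are used.\<close>

definition solves_discrete ::
    "nat \<Rightarrow> real \<Rightarrow> real \<Rightarrow> real \<Rightarrow> real \<Rightarrow> real \<Rightarrow> (nat \<Rightarrow> real) \<Rightarrow> bool" where
  "solves_discrete n h g q b \<alpha> U \<longleftrightarrow>
     - (1 + \<alpha> * h) * U 1 + U 2 = - \<alpha> * h * b - g * h\<^sup>2 / 2 \<and>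
     (\<forall>i\<in>{2..n}. U (i + 1) - 2 * U i + U (i - 1) = - g * h\<^sup>2) \<and>
     - U n + U (n + 1) = - q * h + g * h\<^sup>2 / 2"

definition is_interpolant ::
    "real \<Rightarrow> nat \<Rightarrow> real \<Rightarrow> (nat \<Rightarrow> real) \<Rightarrow> (real \<times> real \<Rightarrow> real) \<Rightarrow> bool" where
  "is_interpolant y0 n h U v \<longleftrightarrow>
     (\<forall>i\<in>{1..n}. \<forall>x\<in>{node h i..node h (i + 1)}. \<forall>y\<in>{0..y0}.
        v (x, y) = U i + (U (i + 1) - U i) / h * (x - node h i))"

text \<open>
  The Bochner integral of a non-integrable function is \<open>0\<close>, so \<open>L2_norm\<close> is meaningful
  only together with \<open>in_L2\<close>.
\<close>

definition in_L2 :: "(real \<times> real) set \<Rightarrow> (real \<times> real \<Rightarrow> real) \<Rightarrow> bool" where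
  "in_L2 A f \<longleftrightarrow> set_borel_measurable lborel A f \<and> set_integrable lborel A (\<lambda>p. (f p)\<^sup>2)"

definition L2_norm :: "(real \<times> real) set \<Rightarrow> (real \<times> real \<Rightarrow> real) \<Rightarrow> real" where
  "L2_norm A f = sqrt (LINT p:A|lborel. (f p)\<^sup>2)"

text \<open>
  The predicates \<open>solves_S\<close>, \<open>solves_discrete\<close> and \<open>is_interpolant\<close> are
  satisfiable, with the expected closed forms.
\<close>

lemma solves_S_explicit:
  assumes "\<alpha> > 0"
  shows "solves_S x0 y0 g q b \<alpha>
    (\<lambda>(x, y). - (1/2) * g * x\<^sup>2 + (g * x0 - q) * x + 1/\<alpha> * (g * x0 - q) + b)"
    (is "solves_S _ _ _ _ _ _ ?u")
proof -
  have dx: "((\<lambda>s. ?u (s, y)) has_real_derivative - g * x + (g * x0 - q)) (at x)" for x y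
    by (auto intro!: derivative_eq_intros)
  have px: "partial_x ?u = (\<lambda>(x, y). - g * x + (g * x0 - q))"
    unfolding partial_x_def using DERIV_imp_deriv[OF dx] by auto
  have dxx: "((\<lambda>s. - g * s + (g * x0 - q)) has_real_derivative - g) (at x)" for x
    by (auto intro!: derivative_eq_intros)
  have pxx: "partial_x (partial_x ?u) = (\<lambda>p. - g)"
    unfolding px unfolding partial_x_def using DERIV_imp_deriv[OF dxx] by auto
  have py: "partial_y ?u = (\<lambda>p. 0)"
    unfolding partial_y_def by auto
  have pyy: "partial_y (partial_y ?u) = (\<lambda>p. 0)"
    unfolding py unfolding partial_y_def by auto
  have cont: "continuous_on A ?u" for A
    unfolding case_prod_unfold by (intro continuous_intros)
  have int: "twice_partially_differentiable_at ?u p \<and> - laplacian ?u p = g" for p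
  proof (cases p)
    case (Pair x y)
    have "(\<lambda>s. ?u (s, y)) differentiable at x"
      using dx[of y x] unfolding real_differentiable_def by blast
    moreover have "(\<lambda>s. - g * s + (g * x0 - q)) differentiable at x"
      using dxx[of x] unfolding real_differentiable_def by blast
    ultimately have "twice_partially_differentiable_at ?u p"
      unfolding Pair twice_partially_differentiable_at_def px py by simp
    moreover have "- laplacian ?u p = g"
      unfolding laplacian_def pxx pyy by simp
    ultimately show ?thesis by blast
  qed
  have hx: "has_normal_derivative ?u (c, 0) (x, y) (c * (- g * x + (g * x0 - q)))" for c x y
    unfolding has_normal_derivative_def
    by (auto intro!: derivative_eq_intros simp: algebra_simps)
  have hy: "has_normal_derivative ?u (0, c) (x, y) 0" for c x y
    unfolding has_normal_derivative_def by auto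
  show ?thesis
    unfolding solves_S_def
  proof (intro conjI cont ballI)
    show "twice_partially_differentiable_at ?u p" "- laplacian ?u p = g" for p
      using int by auto
    show "\<exists>d. has_normal_derivative ?u (-1, 0) p d \<and> - d = \<alpha> * (?u p - b)"
      if p_in: "p \<in> Gamma1 y0" for p
    proof -
      obtain y where p: "p = (0, y)" using p_in by (auto simp: Gamma1_def)
      have "- (-1 * (- g * 0 + (g * x0 - q))) = \<alpha> * (?u p - b)"
        unfolding p using assms by simp
      then show ?thesis using hx[of "-1" 0 y] unfolding p by blast
    qed
    show "\<exists>d. has_normal_derivative ?u (1, 0) p d \<and> - d = q" if p_in: "p \<in> Gamma2 x0 y0" for p
    proof -
      obtain y where p: "p = (x0, y)" using p_in by (auto simp: Gamma2_def)
      have "- (1 * (- g * x0 + (g * x0 - q))) = q" by simp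
      then show ?thesis using hx[of 1 x0 y] unfolding p by blast
    qed
    show "\<exists>d. has_normal_derivative ?u (0, -1) p d \<and> - d = 0"
         "\<exists>d. has_normal_derivative ?u (0, 1) p d \<and> - d = 0" for p
      using hy[of "-1" "fst p" "snd p"] hy[of 1 "fst p" "snd p"]
      by (intro exI[of _ 0] conjI; simp)+
  qed
qed

lemma solves_discrete_explicit:
  assumes "\<alpha> > 0" "n \<ge> 1" "h = x0 / real n"
  shows "solves_discrete n h g q b \<alpha>
    (\<lambda>i. b + 1/\<alpha> * (g * x0 - q) + (real i - 1) * h * (g * x0 - q) - g/2 * ((real i - 1) * h)\<^sup>2)"
proof -
  have x0: "x0 = real n * h" using assms by simp
  show ?thesis
    unfolding solves_discrete_def x0
    using assms(1) by (auto simp: field_simps power2_eq_square of_nat_diff)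
qed

lemma is_interpolant_exists:
  assumes "h > 0"
  shows "\<exists>v. is_interpolant y0 n h U v"
proof -
  define F where "F i x = U i + (U (i + 1) - U i) / h * (x - node h i)" for i x
  define C where "C i x \<longleftrightarrow> i \<in> {1..n} \<and> x \<in> {node h i..node h (i + 1)}" for i x
  have overlap: "F i x = F j x" if "C i x" "C j x" "i < j" for i j x
  proof -
    have "(real j - 1) * h \<le> real i * h"
      using that by (auto simp: C_def node_def)
    then have j: "j = i + 1"
      using assms that(3) by (auto simp: mult_le_cancel_right)
    then have "x = real i * h"
      using that by (auto simp: C_def node_def)
    then show ?thesis
      using assms by (simp add: F_def j node_def field_simps)
  qed
  have uniq: "F i x = F j x" if "C i x" "C j x" for i j x
  proof (cases i j rule: linorder_cases)
    case less then show ?thesis by (rule overlap[OF that])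
  next
    case equal then show ?thesis by simp
  next
    case greater then show ?thesis by (rule overlap[OF that(2,1), symmetric])
  qed
  have "is_interpolant y0 n h U (\<lambda>(x, y). F (SOME i. C i x) x)"
    unfolding is_interpolant_def
  proof (intro ballI)
    fix i x y
    assume "i \<in> {1..n}" "x \<in> {node h i..node h (i + 1)}"
    then have C: "C i x" by (simp add: C_def)
    show "(case (x, y) of (x, y) \<Rightarrow> F (SOME i. C i x) x)
        = U i + (U (i + 1) - U i) / h * (x - node h i)"
      using uniq[OF someI[of "\<lambda>i. C i x", OF C] C] by (simp add: F_def)
  qed
  then show ?thesis by blast
qed

lemma is_interpolant_explicit:
  assumes "is_interpolant y0 n h
      (\<lambda>i. b + 1/\<alpha> * (g * x0 - q) + (real i - 1) * h * (g * x0 - q) - g/2 * ((real i - 1) * h)\<^sup>2) v"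
    and "h > 0" "i \<in> {1..n}" "x \<in> {node h i..node h (i + 1)}" "y \<in> {0..y0}"
  shows "v (x, y) = (g * x0 - q - g * h * (real i - 1/2)) * x + b + 1/\<alpha> * (g * x0 - q)
      + g * h\<^sup>2 / 2 * (real i - 1) * real i"
proof -
  have "v (x, y) = (b + 1/\<alpha> * (g * x0 - q) + (real i - 1) * h * (g * x0 - q)
          - g/2 * ((real i - 1) * h)\<^sup>2)
        + (h * (g * x0 - q) - g/2 * ((real i * h)\<^sup>2 - ((real i - 1) * h)\<^sup>2)) / h
            * (x - (real i - 1) * h)"
    using assms unfolding is_interpolant_def node_def by (auto simp: algebra_simps)
  also have "(h * (g * x0 - q) - g/2 * ((real i * h)\<^sup>2 - ((real i - 1) * h)\<^sup>2)) / h
      = g * x0 - q - g * h * (real i - 1/2)"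
    using assms(2) by (simp add: field_simps power2_eq_square)
  finally show ?thesis by (simp add: field_simps power2_eq_square)
qed

end

theory Submission
  imports Defs
begin

text \<open>
  Both problems determine their solutions, and both solutions are known in closed form, so the
  error can be computed exactly. On a mesh interval, with \<open>t = x - node h i\<close> the distance to
  its left end, the error is \<open>g/2 * t * (h - t)\<close>: the discrete values agree with the
  quadratic \<open>u\<close> at the nodes, so this is the usual interpolation error. The error of the
  \<open>x\<close>-derivative is accordingly \<open>g * (h/2 - t)\<close>. The squares of these polynomials
  integrate over \<open>[0, h]\<close> to \<open>g\<^sup>2 h\<^sup>5 / 120\<close> and \<open>g\<^sup>2 h\<^sup>3 / 12\<close>. Summing over the
  \<open>n = x0 / h\<close> intervals and multiplying by the height \<open>y0\<close> gives the two bounds, in fact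
  with equality.

  The analytic content is uniqueness for the boundary value problem (\<open>solves_S_unique\<close>) at the
  low regularity of \<open>solves_S\<close>, which rules out energy arguments. It follows from a weak
  maximum principle (\<open>weak_maximum_principle\<close>): a barrier turns a positive maximum of a
  subsolution into a contradiction with either the second derivative test or the sign of a
  one-sided normal derivative. Uniqueness for the discrete system
  (\<open>solves_discrete_unique\<close>) is elementary: the interior equations and the one from
  the flux condition make the difference of two solutions constant, the one from the Robin
  condition makes that constant zero.

  The norms are evaluated by \<open>L2_norm_over_mesh\<close>. It prescribes no values on the nodal
  lines, where the derivative of the interpolant is an unspecified number.
\<close>

section \<open>Derivatives at a maximum\<close>

text \<open>
  The first derivative vanishes at the maximum. Were \<open>c > 0\<close>, it would be positive just to
  the right of \<open>x\<close>, so \<open>f\<close> would exceed \<open>f x\<close> there.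
\<close>
lemma second_derivative_nonpos_at_local_max:
  fixes f f' :: "real \<Rightarrow> real"
  assumes f: "\<forall>\<^sub>F s in nhds x. (f has_real_derivative f' s) (at s)"
    and f': "(f' has_real_derivative c) (at x)"
    and max: "\<forall>\<^sub>F s in nhds x. f s \<le> f x"
  shows "c \<le> 0"
proof (rule ccontr)
  assume "\<not> c \<le> 0"
  obtain e where e: "e > 0"
    "\<And>s. dist s x < e \<Longrightarrow> (f has_real_derivative f' s) (at s) \<and> f s \<le> f x"
    using eventually_conj[OF f max] unfolding eventually_nhds_metric by blast
  have "f' x = 0"
    using DERIV_local_max[of f "f' x" x e] e by (auto simp: dist_real_def)
  moreover obtain d where d: "d > 0" "\<And>t. 0 < t \<Longrightarrow> t < d \<Longrightarrow> f' x < f' (x + t)"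
    using DERIV_pos_inc_right[OF f'] \<open>\<not> c \<le> 0\<close> by auto
  define r where "r = min d e / 2"
  have r: "0 < r" "r < d" "r < e" using d(1) e(1) by (auto simp: r_def)
  obtain z where z: "x < z" "z < x + r" "f (x + r) - f x = r * f' z"
    using MVT2[of x "x + r" f f'] e(2) r by (auto simp: dist_real_def)
  have "f' z > 0" using d(2)[of "z - x"] z r \<open>f' x = 0\<close> by auto
  then have "f (x + r) > f x" using z(3) r(1) by (simp add: algebra_simps)
  with e(2)[of "x + r"] r show False by (auto simp: dist_real_def)
qed

text \<open>For \<open>t < 0\<close> the difference quotient has nonpositive numerator and negative denominator.\<close>
lemma normal_derivative_nonneg_at_max:
  assumes d: "has_normal_derivative v \<nu> p d"
    and max: "\<forall>\<^sub>F t in at_left 0. v (p + t *\<^sub>R \<nu>) \<le> v p"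
  shows "0 \<le> d"
proof (rule tendsto_lowerbound)
  show "((\<lambda>t. (v (p + t *\<^sub>R \<nu>) - v p) / t) \<longlongrightarrow> d) (at_left 0)"
    using d unfolding has_normal_derivative_def has_field_derivative_iff by simp
  show "\<forall>\<^sub>F t in at_left 0. 0 \<le> (v (p + t *\<^sub>R \<nu>) - v p) / t"
    using max eventually_at_left_real[of "-1" "0::real", simplified]
    by eventually_elim (auto simp: divide_nonpos_neg)
qed simp

lemma has_normal_derivative_add:
  assumes "has_normal_derivative u \<nu> p d" "has_normal_derivative v \<nu> p e"
  shows "has_normal_derivative (\<lambda>p. u p + v p) \<nu> p (d + e)"
  using assms unfolding has_normal_derivative_def by (rule DERIV_add)

lemma has_normal_derivative_diff:
  assumes "has_normal_derivative u \<nu> p d" "has_normal_derivative v \<nu> p e"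
  shows "has_normal_derivative (\<lambda>p. u p - v p) \<nu> p (d - e)"
  using assms unfolding has_normal_derivative_def by (rule DERIV_diff)

section \<open>Uniqueness for the boundary value problem\<close>

lemma closure_Omega:
  assumes "x0 > 0" "y0 > 0"
  shows "closure (Omega x0 y0) = {0..x0} \<times> {0..y0}"
  using assms by (simp add: Omega_def closure_Times)

lemma partial_derivatives_Omega:
  assumes "\<And>p. p \<in> Omega x0 y0 \<Longrightarrow> twice_partially_differentiable_at u p" "(x, y) \<in> Omega x0 y0"
  shows "((\<lambda>s. u (s, y)) has_real_derivative partial_x u (x, y)) (at x)"
    and "((\<lambda>t. u (x, t)) has_real_derivative partial_y u (x, y)) (at y)"
    and "((\<lambda>s. partial_x u (s, y)) has_real_derivative partial_x (partial_x u) (x, y)) (at x)"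
    and "((\<lambda>t. partial_y u (x, t)) has_real_derivative partial_y (partial_y u) (x, y)) (at y)"
  using assms(1)[OF assms(2)]
  unfolding twice_partially_differentiable_at_def partial_x_def partial_y_def
  by (auto simp: DERIV_deriv_iff_real_differentiable)

lemma eventually_in_Omega:
  assumes "(x, y) \<in> Omega x0 y0"
  shows "\<forall>\<^sub>F s in nhds x. (s, y) \<in> Omega x0 y0" "\<forall>\<^sub>F t in nhds y. (x, t) \<in> Omega x0 y0"
proof -
  have "\<forall>\<^sub>F s in nhds x. s \<in> {0<..<x0}" "\<forall>\<^sub>F t in nhds y. t \<in> {0<..<y0}"
    using assms by (intro eventually_nhds_in_open; auto simp: Omega_def)+
  then show "\<forall>\<^sub>F s in nhds x. (s, y) \<in> Omega x0 y0" "\<forall>\<^sub>F t in nhds y. (x, t) \<in> Omega x0 y0"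
    using assms by (auto simp: Omega_def elim: eventually_mono)
qed

lemma solves_S_diff:
  assumes u: "solves_S x0 y0 g q b \<alpha> u" and v: "solves_S x0 y0 g' q' b' \<alpha> v"
  shows "solves_S x0 y0 (g - g') (q - q') (b - b') \<alpha> (\<lambda>p. u p - v p)"
proof -
  let ?w = "\<lambda>p. u p - v p"
  have tu: "twice_partially_differentiable_at u p" and tv: "twice_partially_differentiable_at v p"
    if "p \<in> Omega x0 y0" for p
    using u v that by (auto simp: solves_S_def)
  note du = partial_derivatives_Omega[OF tu] and dv = partial_derivatives_Omega[OF tv]
  have px: "partial_x ?w (x, y) = partial_x u (x, y) - partial_x v (x, y)"
    and py: "partial_y ?w (x, y) = partial_y u (x, y) - partial_y v (x, y)"
    if "(x, y) \<in> Omega x0 y0" for x y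
    using DERIV_imp_deriv[OF DERIV_diff[OF du(1) dv(1)], OF _ that _ that]
      DERIV_imp_deriv[OF DERIV_diff[OF du(2) dv(2)], OF _ that _ that]
    by (simp_all add: partial_x_def partial_y_def)
  have int: "twice_partially_differentiable_at ?w (x, y) \<and> - laplacian ?w (x, y) = g - g'"
    if p: "(x, y) \<in> Omega x0 y0" for x y
  proof -
    have ex: "\<forall>\<^sub>F s in nhds x. partial_x ?w (s, y) = partial_x u (s, y) - partial_x v (s, y)"
      using eventually_in_Omega(1)[OF p] by eventually_elim (rule px)
    have ey: "\<forall>\<^sub>F t in nhds y. partial_y ?w (x, t) = partial_y u (x, t) - partial_y v (x, t)"
      using eventually_in_Omega(2)[OF p] by eventually_elim (rule py)
    have xx: "((\<lambda>s. partial_x ?w (s, y)) has_real_derivative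
        partial_x (partial_x u) (x, y) - partial_x (partial_x v) (x, y)) (at x)"
      using DERIV_diff[OF du(3)[OF _ p] dv(3)[OF _ p]] by (subst DERIV_cong_ev[OF refl ex refl]) auto
    have yy: "((\<lambda>t. partial_y ?w (x, t)) has_real_derivative
        partial_y (partial_y u) (x, y) - partial_y (partial_y v) (x, y)) (at y)"
      using DERIV_diff[OF du(4)[OF _ p] dv(4)[OF _ p]] by (subst DERIV_cong_ev[OF refl ey refl]) auto
    have "twice_partially_differentiable_at ?w (x, y)"
      using DERIV_diff[OF du(1)[OF _ p] dv(1)[OF _ p]] DERIV_diff[OF du(2)[OF _ p] dv(2)[OF _ p]] xx yy
      unfolding twice_partially_differentiable_at_def
      by (auto simp: real_differentiable_def)
    moreover have "laplacian ?w (x, y) = laplacian u (x, y) - laplacian v (x, y)"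
      using DERIV_imp_deriv[OF xx] DERIV_imp_deriv[OF yy]
      by (simp add: laplacian_def partial_x_def[of "partial_x ?w"] partial_y_def[of "partial_y ?w"])
    ultimately show ?thesis
      using u v p by (auto simp: solves_S_def)
  qed
  have bd: "\<exists>d. has_normal_derivative ?w \<nu> p d \<and> - d = c - c'"
    if ud: "\<exists>d. has_normal_derivative u \<nu> p d \<and> - d = c"
      and vd: "\<exists>d. has_normal_derivative v \<nu> p d \<and> - d = c'"
    for \<nu> p c c'
  proof -
    obtain d d' where "has_normal_derivative u \<nu> p d" "- d = c" "has_normal_derivative v \<nu> p d'" "- d' = c'"
      using ud vd by blast
    then show ?thesis
      by (intro exI[of _ "d - d'"] conjI has_normal_derivative_diff) auto
  qed
  show ?thesis
    unfolding solves_S_def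
  proof (intro conjI ballI)
    show "continuous_on (closure (Omega x0 y0)) ?w"
      using u v by (auto simp: solves_S_def intro: continuous_on_diff)
    show "twice_partially_differentiable_at ?w p" "- laplacian ?w p = g - g'"
      if "p \<in> Omega x0 y0" for p
      using int[of "fst p" "snd p"] that by auto
    show "\<exists>d. has_normal_derivative ?w (-1, 0) p d \<and> - d = \<alpha> * (?w p - (b - b'))"
      if "p \<in> Gamma1 y0" for p
      using bd[of "(-1, 0)" p "\<alpha> * (u p - b)" "\<alpha> * (v p - b')"] u v that
      by (simp add: solves_S_def algebra_simps)
    show "\<exists>d. has_normal_derivative ?w (1, 0) p d \<and> - d = q - q'" if "p \<in> Gamma2 x0 y0" for p
      using bd[of "(1, 0)" p q q'] u v that by (simp add: solves_S_def)
    show "\<exists>d. has_normal_derivative ?w (0, -1) p d \<and> - d = 0" if "p \<in> {0..x0} \<times> {0}" for p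
      using bd[of "(0, -1)" p 0 0] u v that by (auto simp: solves_S_def)
    show "\<exists>d. has_normal_derivative ?w (0, 1) p d \<and> - d = 0" if "p \<in> {0..x0} \<times> {y0}" for p
      using bd[of "(0, 1)" p 0 0] u v that by (auto simp: solves_S_def)
  qed
qed

text \<open>
  Suppose \<open>w p0 > 0\<close> and perturb \<open>w\<close> to \<open>v = w + \<epsilon> \<phi>\<close> with
  \<open>\<phi> = y (y0 - y) + 2 (x - 2 x0)\<^sup>2\<close>. The barrier satisfies \<open>\<Delta>\<phi> = 2 > 0\<close>, so the maximum
  of \<open>v\<close> is not interior, and its outward normal derivative is negative on the right,
  bottom and top sides, so the maximum is not there. By the divergence theorem the normal
  derivative of \<open>\<phi>\<close> must then be positive on the left side (it is \<open>8 x0\<close>), but there the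
  Robin condition contributes \<open>- \<alpha> (w - b)\<close>, which wins for small \<open>\<epsilon>\<close> because \<open>w\<close> is
  bounded below by almost \<open>w p0\<close> at a maximum point of \<open>v\<close>. The corner \<open>(0, 0)\<close>, which is on
  no vertical part of the boundary, is covered by the bottom side.
\<close>
lemma weak_maximum_principle:
  assumes x0: "x0 > 0" and y0: "y0 > 0" and \<alpha>: "\<alpha> > 0"
    and w: "solves_S x0 y0 g q b \<alpha> w" and sgn: "g \<le> 0" "q \<ge> 0" "b \<le> 0"
    and p0: "p0 \<in> {0..x0} \<times> {0..y0}"
  shows "w p0 \<le> 0"
proof (rule ccontr)
  assume "\<not> w p0 \<le> 0"
  then have M: "w p0 > 0" by simp
  let ?R = "{0..x0} \<times> {0..y0}"
  define \<phi> :: "real \<times> real \<Rightarrow> real" where "\<phi> = (\<lambda>(x, y). y * (y0 - y) + 2 * (x - 2 * x0)\<^sup>2)"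
  \<comment> \<open>An upper bound for \<open>\<phi>\<close>; \<open>\<epsilon>\<close> is half the largest value that the left side allows.\<close>
  define K where "K = y0\<^sup>2 + 8 * x0\<^sup>2"
  have \<phi>_nonneg: "0 \<le> \<phi> p" and \<phi>_le: "\<phi> p \<le> K" if in_R: "p \<in> ?R" for p
  proof -
    obtain x y where p: "p = (x, y)" "0 \<le> x" "x \<le> x0" "0 \<le> y" "y \<le> y0" using in_R by auto
    show "0 \<le> \<phi> p" using p by (simp add: \<phi>_def)
    have "y * (y0 - y) \<le> y0 * y0" using p y0 by (intro mult_mono) auto
    moreover have "(x - 2 * x0)\<^sup>2 \<le> (2 * x0)\<^sup>2"
      using p x0 unfolding power2_commute[of x] by (intro power_mono) auto
    ultimately show "\<phi> p \<le> K" by (simp add: p \<phi>_def K_def power2_eq_square)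
  qed
  have K: "K > 0" using x0 y0 by (simp add: K_def add_pos_pos)
  define \<epsilon> where "\<epsilon> = \<alpha> * w p0 / (2 * (\<alpha> * K + 8 * x0))"
  have den: "\<alpha> * K + 8 * x0 > 0" using \<alpha> K x0 by (simp add: add_pos_pos)
  have \<epsilon>: "\<epsilon> > 0" using den M \<alpha> by (simp add: \<epsilon>_def)
  have "\<epsilon> * (\<alpha> * K + 8 * x0) = \<alpha> * w p0 / 2" using den by (simp add: \<epsilon>_def field_simps)
  then have small: "\<epsilon> * (\<alpha> * K + 8 * x0) < \<alpha> * w p0"
    using mult_pos_pos[OF \<alpha> M] by linarith
  define v where "v = (\<lambda>p. w p + \<epsilon> * \<phi> p)"
  have "continuous_on ?R v"
    using w closure_Omega[OF x0 y0]
    unfolding v_def \<phi>_def case_prod_unfold solves_S_def by (auto intro!: continuous_intros)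
  moreover have "compact ?R" by (intro compact_Times) auto
  ultimately obtain p where p: "p \<in> ?R" and max: "\<And>p'. p' \<in> ?R \<Longrightarrow> v p' \<le> v p"
    using continuous_attains_sup[of ?R v] p0 by blast
  obtain x y where xy: "p = (x, y)" "0 \<le> x" "x \<le> x0" "0 \<le> y" "y \<le> y0" using p by auto
  have \<phi>x: "has_normal_derivative \<phi> (c, 0) (x, y) (c * (4 * (x - 2 * x0)))" for c x y
    unfolding has_normal_derivative_def \<phi>_def
    by (auto intro!: derivative_eq_intros simp: algebra_simps)
  have \<phi>y: "has_normal_derivative \<phi> (0, c) (x, y) (c * (y0 - 2 * y))" for c x y
    unfolding has_normal_derivative_def \<phi>_def
    by (auto intro!: derivative_eq_intros simp: algebra_simps)
  have bd: "0 \<le> d + \<epsilon> * e"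
    if "has_normal_derivative w \<nu> p d" "has_normal_derivative \<phi> \<nu> p e"
      and "\<forall>\<^sub>F t in at_left 0. p + t *\<^sub>R \<nu> \<in> ?R" for \<nu> d e
  proof (rule normal_derivative_nonneg_at_max)
    have "has_normal_derivative (\<lambda>p. \<epsilon> * \<phi> p) \<nu> p (\<epsilon> * e)"
      using that(2) unfolding has_normal_derivative_def by (rule DERIV_cmult)
    then show "has_normal_derivative v \<nu> p (d + \<epsilon> * e)"
      unfolding v_def by (intro has_normal_derivative_add that(1))
    show "\<forall>\<^sub>F t in at_left 0. v (p + t *\<^sub>R \<nu>) \<le> v p"
      using that(3) by eventually_elim (rule max)
  qed
  have near0: "\<forall>\<^sub>F t in at_left 0. t \<in> {- x0<..<0} \<and> t \<in> {- y0<..<0}"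
    using x0 y0 by (intro eventually_conj eventually_at_left_real) auto
  \<comment> \<open>A maximum point of \<open>v\<close> is nearly one of \<open>w\<close>, since \<open>0 \<le> \<phi> \<le> K\<close>.\<close>
  have wp: "w p \<ge> w p0 - \<epsilon> * K"
  proof -
    have "w p0 \<le> v p0" using \<phi>_nonneg[OF p0] \<epsilon> by (simp add: v_def)
    also have "\<dots> \<le> w p + \<epsilon> * \<phi> p" using max[OF p0] by (simp add: v_def)
    also have "\<dots> \<le> w p + \<epsilon> * K" using \<phi>_le[OF p] \<epsilon> by simp
    finally show ?thesis by simp
  qed
  consider "y = 0" | "y = y0" | "0 < y" "x = 0" | "0 < y" "x = x0" | "p \<in> Omega x0 y0"
    using xy by (force simp: Omega_def)
  then show False
  proof cases
    case 1
    then obtain d where "has_normal_derivative w (0, -1) p d" "d = 0"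
      using w xy unfolding solves_S_def by auto
    moreover have "\<forall>\<^sub>F t in at_left 0. p + t *\<^sub>R (0, -1) \<in> ?R"
      using near0 by eventually_elim (use xy 1 in auto)
    ultimately have "0 \<le> d + \<epsilon> * (-1 * (y0 - 2 * y))"
      using \<phi>y[of "-1" x y] by (intro bd) (auto simp: xy)
    then show False using \<open>d = 0\<close> mult_pos_pos[OF \<epsilon> y0] 1 by simp
  next
    case 2
    then obtain d where "has_normal_derivative w (0, 1) p d" "d = 0"
      using w xy unfolding solves_S_def by auto
    moreover have "\<forall>\<^sub>F t in at_left 0. p + t *\<^sub>R (0, 1) \<in> ?R"
      using near0 by eventually_elim (use xy 2 in auto)
    ultimately have "0 \<le> d + \<epsilon> * (1 * (y0 - 2 * y))"
      using \<phi>y[of 1 x y] by (intro bd) (auto simp: xy)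
    then show False using \<open>d = 0\<close> mult_pos_pos[OF \<epsilon> y0] 2 by simp
  next
    case 3
    then have "p \<in> Gamma1 y0" using xy by (auto simp: Gamma1_def)
    then obtain d where d: "has_normal_derivative w (-1, 0) p d" "- d = \<alpha> * (w p - b)"
      using w unfolding solves_S_def by blast
    have "\<forall>\<^sub>F t in at_left 0. p + t *\<^sub>R (-1, 0) \<in> ?R"
      using near0 by eventually_elim (use xy 3 in auto)
    then have "0 \<le> d + \<epsilon> * (-1 * (4 * (x - 2 * x0)))"
      using \<phi>x[of "-1" x y] d(1) by (intro bd) (auto simp: xy)
    then have "\<alpha> * (w p - b) \<le> \<epsilon> * (8 * x0)" using d(2) 3 by simp
    moreover have "\<alpha> * (w p0 - \<epsilon> * K) \<le> \<alpha> * (w p - b)"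
      using wp sgn \<alpha> by (intro mult_left_mono) auto
    ultimately show False using small by (simp add: algebra_simps)
  next
    case 4
    then have "p \<in> Gamma2 x0 y0" using xy by (auto simp: Gamma2_def)
    then obtain d where d: "has_normal_derivative w (1, 0) p d" "- d = q"
      using w unfolding solves_S_def by blast
    have "\<forall>\<^sub>F t in at_left 0. p + t *\<^sub>R (1, 0) \<in> ?R"
      using near0 by eventually_elim (use xy 4 in auto)
    then have "0 \<le> d + \<epsilon> * (1 * (4 * (x - 2 * x0)))"
      using \<phi>x[of 1 x y] d(1) by (intro bd) (auto simp: xy)
    moreover have "\<epsilon> * x0 > 0" using \<epsilon> x0 by simp
    ultimately show False using d(2) sgn 4 by (simp add: algebra_simps)
  next
    case 5
    then have in_Om: "(x, y) \<in> Omega x0 y0" by (simp add: xy)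
    have tw: "twice_partially_differentiable_at w p'" if "p' \<in> Omega x0 y0" for p'
      using w that by (auto simp: solves_S_def)
    note dw = partial_derivatives_Omega[OF tw]
    have sub: "p' \<in> ?R" if "p' \<in> Omega x0 y0" for p' using that by (auto simp: Omega_def)
    have "partial_x (partial_x w) (x, y) + \<epsilon> * 4 \<le> 0"
    proof (rule second_derivative_nonpos_at_local_max)
      show "\<forall>\<^sub>F s in nhds x. ((\<lambda>s. v (s, y)) has_real_derivative
          partial_x w (s, y) + \<epsilon> * (4 * (s - 2 * x0))) (at s)"
        using eventually_in_Omega(1)[OF in_Om]
        by eventually_elim (auto simp: v_def \<phi>_def intro!: derivative_eq_intros dw(1))
      show "((\<lambda>s. partial_x w (s, y) + \<epsilon> * (4 * (s - 2 * x0))) has_real_derivative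
          partial_x (partial_x w) (x, y) + \<epsilon> * 4) (at x)"
        by (auto intro!: derivative_eq_intros dw(3) in_Om)
      show "\<forall>\<^sub>F s in nhds x. v (s, y) \<le> v (x, y)"
        using eventually_in_Omega(1)[OF in_Om] by eventually_elim (use max sub xy in auto)
    qed
    moreover have "partial_y (partial_y w) (x, y) + \<epsilon> * (- 2) \<le> 0"
    proof (rule second_derivative_nonpos_at_local_max)
      show "\<forall>\<^sub>F t in nhds y. ((\<lambda>t. v (x, t)) has_real_derivative
          partial_y w (x, t) + \<epsilon> * (y0 - 2 * t)) (at t)"
        using eventually_in_Omega(2)[OF in_Om]
        by eventually_elim (auto simp: v_def \<phi>_def intro!: derivative_eq_intros dw(2))
      show "((\<lambda>t. partial_y w (x, t) + \<epsilon> * (y0 - 2 * t)) has_real_derivative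
          partial_y (partial_y w) (x, y) + \<epsilon> * (- 2)) (at y)"
        by (auto intro!: derivative_eq_intros dw(4) in_Om)
      show "\<forall>\<^sub>F t in nhds y. v (x, t) \<le> v (x, y)"
        using eventually_in_Omega(2)[OF in_Om] by eventually_elim (use max sub xy in auto)
    qed
    moreover have "partial_x (partial_x w) (x, y) + partial_y (partial_y w) (x, y) = - g"
      using w in_Om by (force simp: solves_S_def laplacian_def)
    ultimately show False using \<epsilon> sgn by simp
  qed
qed

theorem solves_S_unique:
  assumes "x0 > 0" "y0 > 0" "\<alpha> > 0"
    and u: "solves_S x0 y0 g q b \<alpha> u" and v: "solves_S x0 y0 g q b \<alpha> v"
    and p: "p \<in> {0..x0} \<times> {0..y0}"
  shows "u p = v p"
  using weak_maximum_principle[OF assms(1-3) solves_S_diff[OF u v] _ _ _ p]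
    weak_maximum_principle[OF assms(1-3) solves_S_diff[OF v u] _ _ _ p] by simp

section \<open>Uniqueness for the discrete system\<close>

lemma solves_discrete_unique:
  assumes U: "solves_discrete n h g q b \<alpha> U" and V: "solves_discrete n h g q b \<alpha> V"
    and pos: "\<alpha> > 0" "h > 0" "n \<ge> 1" and i: "i \<in> {1..n + 1}"
  shows "U i = V i"
proof -
  define W where "W i = U i - V i" for i
  have first: "W 2 = (1 + \<alpha> * h) * W 1" and last: "W (n + 1) = W n"
    using U V by (simp_all add: solves_discrete_def W_def algebra_simps)
  have rec: "W (i + 1) - 2 * W i + W (i - 1) = 0" if "i \<in> {2..n}" for i
  proof -
    have "U (i + 1) - 2 * U i + U (i - 1) = V (i + 1) - 2 * V i + V (i - 1)"
      using U V that by (simp add: solves_discrete_def)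
    then show ?thesis by (simp add: W_def algebra_simps)
  qed
  \<comment> \<open>The last equation gives a zero increment; the interior equations carry it down the mesh.\<close>
  have step: "W (n + 1 - k) = W (n - k)" if "k < n" for k
    using that
  proof (induction k)
    case 0 then show ?case using last by simp
  next
    case (Suc k)
    then show ?case using rec[of "n - k"] by (simp add: Suc_diff_Suc Suc_diff_le)
  qed
  have const: "W (i + 1) = W i" if "i \<in> {1..n}" for i
    using step[of "n - i"] that by (simp add: Suc_diff_le)
  \<comment> \<open>The first equation now reads \<open>\<alpha> h W\<^sub>1 = 0\<close>.\<close>
  have "W 1 = 0"
    using const[of 1] first pos by (simp add: numeral_2_eq_2 algebra_simps)
  have "W i = 0" if "1 \<le> i" "i \<le> n + 1" for i
    using that
  proof (induction i rule: dec_induct)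
    case (step m) then show ?case using const[of m] by simp
  qed (use \<open>W 1 = 0\<close> in simp)
  then show ?thesis using i by (simp add: W_def)
qed


section \<open>Integrating a function that repeats on every mesh interval\<close>

lemma ex_mesh_interval:
  assumes "h > 0" "0 < x" "x < real n * h" "x \<notin> node h ` {1..n + 1}"
  obtains i where "i \<in> {1..n}" "node h i < x" "x < node h (i + 1)"
proof -
  define k where "k = nat \<lfloor>x / h\<rfloor>"
  have "x / h \<ge> 0" using assms by simp
  then have "real k \<le> x / h" "x / h < real k + 1" by (simp_all add: k_def)
  then have k: "real k * h \<le> x" "x < (real k + 1) * h"
    using assms(1) by (simp_all add: field_simps)
  have "real k * h < real n * h" using k assms(3) by simp
  then have "k < n" using assms(1) by simp
  moreover have "x \<noteq> node h (k + 1)" using assms(4) \<open>k < n\<close> by auto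
  ultimately show ?thesis using that[of "k + 1"] k by (simp add: node_def add.commute)
qed

lemma mesh_interval_unique:
  assumes "h > 0" "node h i < x" "x < node h (i + 1)" "node h j \<le> x" "x \<le> node h (j + 1)"
  shows "i = j"
proof -
  have "(real i - 1) * h < real j * h" "(real j - 1) * h < real i * h"
    using assms(2-) unfolding node_def by auto
  then have "real i - 1 < real j" "real j - 1 < real i"
    using assms(1) mult_less_cancel_right_pos by blast+
  then show ?thesis by simp
qed

text \<open>
  The right-hand side is a function with arbitrary values at the nodes; the left-hand side is
  visibly Borel and integrable when \<open>P\<close> is continuous. They differ on a finite set only, which transfers both
  properties.
\<close>
lemma sum_over_mesh_eq:
  fixes G P :: "real \<Rightarrow> real"
  assumes h: "h > 0"
    and G: "\<And>i x. i \<in> {1..n} \<Longrightarrow> node h i < x \<Longrightarrow> x < node h (i + 1) \<Longrightarrow> G x = P (x - node h i)"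
    and x: "x \<notin> node h ` {1..n + 1}"
  shows "(\<Sum>i=1..n. indicator {node h i..node h (i + 1)} x * P (x - node h i))
    = indicator {0<..<real n * h} x * G x" (is "(\<Sum>i=1..n. ?F i) = _")
proof (cases "x \<in> {0<..<real n * h}")
  case True
  then obtain i where i: "i \<in> {1..n}" "node h i < x" "x < node h (i + 1)"
    using ex_mesh_interval[OF h _ _ x] by auto
  have "(\<Sum>j=1..n. ?F j) = (\<Sum>j=1..n. if j = i then G x else 0)"
    using i mesh_interval_unique[OF h i(2,3)] G[OF i]
    by (intro sum.cong) (auto simp: indicator_def)
  then show ?thesis using i True by simp
next
  case False
  have "?F i = 0" if i: "i \<in> {1..n}" for i
  proof -
    have "0 \<le> node h i" "node h (i + 1) \<le> real n * h"
      using i h by (auto simp: node_def)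
    moreover have "node h 1 = 0" "node h (n + 1) = real n * h" by (simp_all add: node_def)
    then have "x \<noteq> 0" "x \<noteq> real n * h" using x i by (force, force)
    ultimately show ?thesis using False by (auto simp: indicator_def)
  qed
  then have "(\<Sum>i=1..n. ?F i) = 0" by (intro sum.neutral) blast
  then show ?thesis using False by simp
qed

lemma integral_over_mesh:
  fixes G P Q :: "real \<Rightarrow> real"
  assumes h: "h > 0"
    and G: "\<And>i x. i \<in> {1..n} \<Longrightarrow> node h i < x \<Longrightarrow> x < node h (i + 1) \<Longrightarrow> G x = P (x - node h i)"
    and Q: "\<And>t. (Q has_real_derivative P t) (at t)" and P: "continuous_on UNIV P"
  shows "has_bochner_integral lborel (\<lambda>x. indicator {0<..<real n * h} x * G x)
    (real n * (Q h - Q 0))"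
proof -
  have "has_bochner_integral lborel
      (\<lambda>x. indicator {node h i..node h (i + 1)} x * P (x - node h i)) (Q h - Q 0)" for i
  proof -
    have "((\<lambda>x. x - node h i) has_real_derivative 1) (at x)" for x
      by (auto intro!: derivative_eq_intros)
    from DERIV_chain2[OF Q this]
    have 1: "((\<lambda>x. Q (x - node h i)) has_real_derivative P (x - node h i)) (at x)" for x
      by (simp only: mult_1_right)
    have 2: "isCont (\<lambda>x. P (x - node h i)) x" for x
    proof -
      have "isCont (\<lambda>x. x - node h i) x" by (intro continuous_intros)
      moreover have "isCont P (x - node h i)" using P by (simp add: continuous_on_eq_continuous_at)
      ultimately show ?thesis by (rule isCont_o2)
    qed
    have 3: "node h (i + 1) - node h i = h" and 4: "node h i \<le> node h (i + 1)"
      using h by (simp_all add: node_def algebra_simps)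
    have "has_bochner_integral lborel
        (\<lambda>x. P (x - node h i) * indicator {node h i..node h (i + 1)} x)
        (Q (node h (i + 1) - node h i) - Q (node h i - node h i))"
      by (rule has_bochner_integral_FTC_Icc_real[OF 4 1 2])
    then show ?thesis unfolding 3 by (simp only: mult.commute diff_self)
  qed
  then have "has_bochner_integral lborel
      (\<lambda>x. \<Sum>i=1..n. indicator {node h i..node h (i + 1)} x * P (x - node h i))
      (\<Sum>i=1..n. Q h - Q 0)"
    by (intro has_bochner_integral_sum)
  moreover have "has_bochner_integral lborel
      (\<lambda>x. \<Sum>i=1..n. indicator {node h i..node h (i + 1)} x * P (x - node h i)) I
      \<longleftrightarrow> has_bochner_integral lborel (\<lambda>x. indicator {0<..<real n * h} x * G x) I" for I
    by (rule has_bochner_integral_discrete_difference[where X = "node h ` {1..n + 1}"])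
      (auto simp: sum_over_mesh_eq[of h n G P, OF h G, simplified] intro: countable_finite)
  ultimately show ?thesis by simp
qed

lemma borel_measurable_over_mesh:
  fixes G P :: "real \<Rightarrow> real"
  assumes h: "h > 0"
    and G: "\<And>i x. i \<in> {1..n} \<Longrightarrow> node h i < x \<Longrightarrow> x < node h (i + 1) \<Longrightarrow> G x = P (x - node h i)"
    and P: "continuous_on UNIV P"
  shows "(\<lambda>x. indicator {0<..<real n * h} x * G x) \<in> borel_measurable borel"
proof (rule measurable_discrete_difference[where X = "node h ` {1..n + 1}"])
  have [measurable]: "P \<in> borel_measurable borel" using P by (rule borel_measurable_continuous_onI)
  show "(\<lambda>x. \<Sum>i=1..n. indicator {node h i..node h (i + 1)} x * P (x - node h i)) \<in> borel_measurable borel"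
    by measurable
qed (use sum_over_mesh_eq[of h n G P, OF h G] in \<open>auto intro: countable_finite\<close>)

lemma has_bochner_integral_lborel_times:
  fixes k l :: "real \<Rightarrow> real"
  assumes k: "has_bochner_integral lborel k c" and l: "has_bochner_integral lborel l d"
  shows "has_bochner_integral lborel (\<lambda>p. k (fst p) * l (snd p)) (c * d)"
proof -
  have [measurable]: "k \<in> borel_measurable lborel" "l \<in> borel_measurable lborel"
    using k l by (auto dest: has_bochner_integral_integrable)
  have ik: "integrable lborel k" "integral\<^sup>L lborel k = c"
    and il: "integrable lborel l" "integral\<^sup>L lborel l = d"
    using k l by (auto simp: has_bochner_integral_iff)
  have int: "integrable (lborel \<Otimes>\<^sub>M lborel) (\<lambda>p. k (fst p) * l (snd p))"
    using ik il by (intro lborel_pair.Fubini_integrable) (auto simp: abs_mult)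
  moreover have "integral\<^sup>L (lborel \<Otimes>\<^sub>M lborel) (\<lambda>p. k (fst p) * l (snd p)) = c * d"
    using lborel_pair.integral_fst'[OF int] ik il by simp
  ultimately show ?thesis by (simp add: has_bochner_integral_iff lborel_prod)
qed

text \<open>
  The function \<open>f\<close> must depend on \<open>x\<close> alone also on the nodal lines: agreement almost
  everywhere with a Borel function would not make it Borel measurable.
\<close>
lemma L2_norm_over_mesh:
  fixes P Q G :: "real \<Rightarrow> real" and f :: "real \<times> real \<Rightarrow> real"
  assumes h: "h > 0" and y0: "y0 > 0"
    and f: "\<And>x y. (x, y) \<in> Omega (real n * h) y0 \<Longrightarrow> f (x, y) = G x"
    and G: "\<And>i x. i \<in> {1..n} \<Longrightarrow> node h i < x \<Longrightarrow> x < node h (i + 1) \<Longrightarrow> G x = P (x - node h i)"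
    and P: "continuous_on UNIV P"
    and Q: "\<And>t. (Q has_real_derivative (P t)\<^sup>2) (at t)"
  shows "in_L2 (Omega (real n * h) y0) f"
    and "L2_norm (Omega (real n * h) y0) f = sqrt (real n * (Q h - Q 0) * y0)"
proof -
  let ?A = "Omega (real n * h) y0"
  let ?k = "\<lambda>x. indicator {0<..<real n * h} x * G x"
  let ?l = "indicator {0<..<y0} :: real \<Rightarrow> real"
  have [measurable]: "?k \<in> borel_measurable borel"
    by (rule borel_measurable_over_mesh[OF h G P])
  have "(\<lambda>p. indicator ?A p *\<^sub>R f p) = (\<lambda>p. ?k (fst p) * ?l (snd p))"
    using f by (auto simp: indicator_def Omega_def fun_eq_iff)
  then have meas: "set_borel_measurable lborel ?A f"
    unfolding set_borel_measurable_def by (simp add: borel_prod[symmetric])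
  have "has_bochner_integral lborel (\<lambda>x. indicator {0<..<real n * h} x * (G x)\<^sup>2)
      (real n * (Q h - Q 0))"
    by (rule integral_over_mesh[where P = "\<lambda>t. (P t)\<^sup>2"])
      (auto intro!: h Q continuous_on_power P simp: G)
  moreover have "has_bochner_integral lborel ?l y0"
    using y0 by (simp add: has_bochner_integral_iff)
  ultimately have "has_bochner_integral lborel
      (\<lambda>p. indicator {0<..<real n * h} (fst p) * (G (fst p))\<^sup>2 * ?l (snd p))
      (real n * (Q h - Q 0) * y0)"
    by (rule has_bochner_integral_lborel_times)
  also have "(\<lambda>p. indicator {0<..<real n * h} (fst p) * (G (fst p))\<^sup>2 * ?l (snd p))
      = (\<lambda>p. indicator ?A p *\<^sub>R (f p)\<^sup>2)"
    using f by (auto simp: indicator_def Omega_def fun_eq_iff)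
  finally show "in_L2 ?A f" "L2_norm ?A f = sqrt (real n * (Q h - Q 0) * y0)"
    using meas
    by (simp_all add: in_L2_def L2_norm_def set_integrable_def set_lebesgue_integral_def
        has_bochner_integral_iff)
qed

section \<open>The error of the modified scheme\<close>

theorem lemma22:
  fixes x0 y0 g q b \<alpha> h :: real and n :: nat
    and u uh :: "real \<times> real \<Rightarrow> real" and U :: "nat \<Rightarrow> real"
  assumes "x0 > 0" and "y0 > 0" and "\<alpha> > 0"
    and "solves_S x0 y0 g q b \<alpha> u"
    and "n \<ge> 1" and "h = x0 / real n"
    and "solves_discrete n h g q b \<alpha> U"
    and "is_interpolant y0 n h U uh"
  shows "in_L2 (Omega x0 y0) (\<lambda>p. u p - uh p) \<and>
         L2_norm (Omega x0 y0) (\<lambda>p. u p - uh p) \<le> sqrt (x0 * y0 / 120) * \<bar>g\<bar> * h\<^sup>2 \<and>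
         in_L2 (Omega x0 y0) (\<lambda>p. partial_x u p - partial_x uh p) \<and>
         L2_norm (Omega x0 y0) (\<lambda>p. partial_x u p - partial_x uh p) \<le> sqrt (x0 * y0 / 12) * \<bar>g\<bar> * h"
proof -
  have h: "h > 0" and x0: "real n * h = x0" using assms(1,5,6) by auto
  define V where "V i = b + 1/\<alpha> * (g * x0 - q) + (real i - 1) * h * (g * x0 - q)
    - g/2 * ((real i - 1) * h)\<^sup>2" for i
  have "solves_discrete n h g q b \<alpha> V"
    unfolding V_def using solves_discrete_explicit assms(3,5,6) .
  then have UV: "U i = V i" if "i \<in> {1..n + 1}" for i
    using solves_discrete_unique assms(3,5,7) h that by blast
  then have "is_interpolant y0 n h V uh"
    using assms(8) by (auto simp: is_interpolant_def)
  then have uh: "uh (x, y) = (g * x0 - q - g * h * (real i - 1/2)) * x + b + 1/\<alpha> * (g * x0 - q)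
      + g * h\<^sup>2 / 2 * (real i - 1) * real i"
    if "i \<in> {1..n}" "node h i \<le> x" "x \<le> node h (i + 1)" "0 \<le> y" "y \<le> y0" for i x y
    using is_interpolant_explicit[OF _ h] that unfolding V_def by auto
  have u: "u (x, y) = - (1/2) * g * x\<^sup>2 + (g * x0 - q) * x + 1/\<alpha> * (g * x0 - q) + b"
    if "0 \<le> x" "x \<le> x0" "0 \<le> y" "y \<le> y0" for x y
    using solves_S_unique[OF assms(1-4) solves_S_explicit[OF assms(3)], of "(x, y)"] that by simp
  have node_bounds: "0 \<le> node h i" "node h (i + 1) \<le> x0" if "i \<in> {1..n}" for i
    using that h x0 by (auto simp: node_def simp flip: x0)
  \<comment> \<open>The height \<open>y0 / 2\<close> represents all heights: on the rectangle nothing depends on \<open>y\<close>.\<close>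
  have "y0 / 2 \<in> {0<..<y0}" using assms(2) by simp
  have err: "u (x, y) - uh (x, y) = g / 2 * ((x - node h i) * (h - (x - node h i)))"
    if "i \<in> {1..n}" "node h i \<le> x" "x \<le> node h (i + 1)" "0 \<le> y" "y \<le> y0" for i x y
  proof -
    have "u (x, y) - uh (x, y) = - (1/2) * g * x\<^sup>2 + g * h * (real i - 1/2) * x
        - g * h\<^sup>2 / 2 * (real i - 1) * real i"
      using u[of x y] uh[OF that] node_bounds[OF that(1)] that by (simp add: left_diff_distrib)
    also have "\<dots> = g / 2 * ((x - node h i) * (h - (x - node h i)))"
      by (simp add: node_def power2_eq_square field_simps)
    finally show ?thesis .
  qed
  have ux: "partial_x u (x, y) = - g * x + (g * x0 - q)" if "(x, y) \<in> Omega x0 y0" for x y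
  proof -
    have germ: "\<forall>\<^sub>F s in nhds x. u (s, y)
        = - (1/2) * g * s\<^sup>2 + (g * x0 - q) * s + 1/\<alpha> * (g * x0 - q) + b"
      using eventually_in_Omega(1)[OF that] by eventually_elim (rule u; simp add: Omega_def)
    have "deriv (\<lambda>s. - (1/2) * g * s\<^sup>2 + (g * x0 - q) * s + 1/\<alpha> * (g * x0 - q) + b) x
        = - g * x + (g * x0 - q)"
      by (rule DERIV_imp_deriv) (auto intro!: derivative_eq_intros)
    with deriv_cong_ev[OF germ refl] show ?thesis
      unfolding partial_x_def prod.case by (rule trans)
  qed
  have uhx: "partial_x uh (x, y) = g * x0 - q - g * h * (real i - 1/2)"
    if i: "i \<in> {1..n}" "node h i < x" "x < node h (i + 1)" and y: "0 \<le> y" "y \<le> y0" for i x y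
  proof -
    have "\<forall>\<^sub>F s in nhds x. s \<in> {node h i<..<node h (i + 1)}"
      using i by (intro eventually_nhds_in_open) auto
    then have germ: "\<forall>\<^sub>F s in nhds x. uh (s, y) = (g * x0 - q - g * h * (real i - 1/2)) * s + b
        + 1/\<alpha> * (g * x0 - q) + g * h\<^sup>2 / 2 * (real i - 1) * real i"
      by eventually_elim (rule uh; use i y in simp)
    have "deriv (\<lambda>s. (g * x0 - q - g * h * (real i - 1/2)) * s + b
        + 1/\<alpha> * (g * x0 - q) + g * h\<^sup>2 / 2 * (real i - 1) * real i) x
        = g * x0 - q - g * h * (real i - 1/2)"
      by (rule DERIV_imp_deriv) (auto intro!: derivative_eq_intros)
    with deriv_cong_ev[OF germ refl] show ?thesis
      unfolding partial_x_def prod.case by (rule trans)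
  qed
  have uh_y: "uh (x, y) = uh (x, y0 / 2)" if in_Om: "(x, y) \<in> Omega x0 y0" for x y
  proof -
    have x: "0 < x" "x < real n * h" and y: "0 < y" "y < y0"
      using in_Om by (simp_all add: Omega_def x0)
    obtain i where "i \<in> {1..n}" "node h i \<le> x" "x \<le> node h (i + 1)"
    proof (cases "x \<in> node h ` {1..n + 1}")
      case True
      then obtain j where j: "x = node h j" "1 \<le> j" "j \<le> n + 1" by auto
      have "j \<noteq> n + 1" using x(2) j(1) by (auto simp: node_def)
      then show ?thesis using that[of j] j h by (simp add: node_def)
    next
      case False
      then obtain i where "i \<in> {1..n}" "node h i < x" "x < node h (i + 1)"
        using ex_mesh_interval[OF h x] by blast
      then show ?thesis by (intro that[of i]) auto
    qed
    then show ?thesis using y \<open>y0 / 2 \<in> _\<close> by (simp add: uh)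
  qed
  \<comment> \<open>Equal germs have equal \<open>deriv\<close> even where no derivative exists, so the nodal lines are
     covered.\<close>
  have uhx_y: "partial_x uh (x, y) = partial_x uh (x, y0 / 2)" if "(x, y) \<in> Omega x0 y0" for x y
  proof -
    have "\<forall>\<^sub>F s in nhds x. uh (s, y) = uh (s, y0 / 2)"
      using eventually_in_Omega(1)[OF that] by eventually_elim (rule uh_y)
    then show ?thesis unfolding partial_x_def by (simp add: deriv_cong_ev)
  qed
  have mid: "(x, y0 / 2) \<in> Omega x0 y0" if "(x, y) \<in> Omega x0 y0" for x y
    using that by (auto simp: Omega_def)

  let ?e = "\<lambda>p. u p - uh p" and ?d = "\<lambda>p. partial_x u p - partial_x uh p"
  have e: "in_L2 (Omega x0 y0) ?e \<and> L2_norm (Omega x0 y0) ?e = sqrt (real n * (g\<^sup>2 * h^5 / 120) * y0)"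
  proof -
    let ?P = "\<lambda>t. g / 2 * (t * (h - t))"
    let ?Q = "\<lambda>t. g\<^sup>2 / 4 * (h\<^sup>2 * t^3 / 3 - h * t^4 / 2 + t^5 / 5)"
    have f: "?e (x, y) = ?e (x, y0 / 2)" if "(x, y) \<in> Omega x0 y0" for x y
      using uh_y[OF that] u that mid[OF that] by (auto simp: Omega_def)
    have G: "?e (x, y0 / 2) = ?P (x - node h i)"
      if "i \<in> {1..n}" "node h i < x" "x < node h (i + 1)" for i x
      using err that assms(2) by simp
    have P: "continuous_on UNIV ?P" by (intro continuous_intros)
    have Q: "(?Q has_real_derivative (?P t)\<^sup>2) (at t)" for t
      by (auto intro!: derivative_eq_intros simp: field_simps power2_eq_square eval_nat_numeral)
    have Q_incr: "?Q h - ?Q 0 = g\<^sup>2 * h^5 / 120"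
      by (simp add: field_simps eval_nat_numeral)
    note norm = L2_norm_over_mesh[OF h assms(2), of n ?e "\<lambda>x. ?e (x, y0 / 2)" ?P ?Q,
        unfolded x0, OF f G P Q]
    show ?thesis by (rule conjI[OF norm[unfolded Q_incr]])
  qed
  have d: "in_L2 (Omega x0 y0) ?d \<and> L2_norm (Omega x0 y0) ?d = sqrt (real n * (g\<^sup>2 * h^3 / 12) * y0)"
  proof -
    let ?P = "\<lambda>t. g * (h / 2 - t)"
    let ?Q = "\<lambda>t. g\<^sup>2 * (h\<^sup>2 * t / 4 - h * t^2 / 2 + t^3 / 3)"
    have f: "?d (x, y) = ?d (x, y0 / 2)" if "(x, y) \<in> Omega x0 y0" for x y
      using uhx_y[OF that] ux[OF that] ux[OF mid[OF that]] by simp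
    have G: "?d (x, y0 / 2) = ?P (x - node h i)"
      if i: "i \<in> {1..n}" "node h i < x" "x < node h (i + 1)" for i x
    proof -
      have "(x, y0 / 2) \<in> Omega x0 y0"
        using i node_bounds[OF i(1)] assms(2) by (auto simp: Omega_def)
      from ux[OF this] show ?thesis
        using uhx[OF i, of "y0 / 2"] assms(2) by (simp add: node_def algebra_simps)
    qed
    have P: "continuous_on UNIV ?P" by (intro continuous_intros)
    have Q: "(?Q has_real_derivative (?P t)\<^sup>2) (at t)" for t
      by (auto intro!: derivative_eq_intros simp: field_simps power2_eq_square eval_nat_numeral)
    have Q_incr: "?Q h - ?Q 0 = g\<^sup>2 * h^3 / 12"
      by (simp add: field_simps eval_nat_numeral)
    note norm = L2_norm_over_mesh[OF h assms(2), of n ?d "\<lambda>x. ?d (x, y0 / 2)" ?P ?Q,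
        unfolded x0, OF f G P Q]
    show ?thesis by (rule conjI[OF norm[unfolded Q_incr]])
  qed
  have "real n * (g\<^sup>2 * h^5 / 120) * y0 = x0 * y0 / 120 * (\<bar>g\<bar> * h\<^sup>2)\<^sup>2"
    unfolding x0[symmetric] by (simp add: field_simps eval_nat_numeral)
  then have se: "sqrt (real n * (g\<^sup>2 * h^5 / 120) * y0) = sqrt (x0 * y0 / 120) * \<bar>g\<bar> * h\<^sup>2"
    by (simp only: real_sqrt_mult[of _ "_\<^sup>2"] real_sqrt_abs) (simp add: abs_mult)
  have "real n * (g\<^sup>2 * h^3 / 12) * y0 = x0 * y0 / 12 * (\<bar>g\<bar> * h)\<^sup>2"
    unfolding x0[symmetric] by (simp add: field_simps eval_nat_numeral)
  then have sd: "sqrt (real n * (g\<^sup>2 * h^3 / 12) * y0) = sqrt (x0 * y0 / 12) * \<bar>g\<bar> * h"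
    using h by (simp only: real_sqrt_mult[of _ "_\<^sup>2"] real_sqrt_abs) (simp add: abs_mult)
  show ?thesis using e d se sd by simp
qed

end
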